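(* Let $A\in\mathbb{R}^{n\times n}$, $q\in\mathbb{R}^n$, $y^{(0)}\in\mathcal{F}_1$. If the homotopy curve $\Gamma_y^{(0)}$ is smooth, then the positive predictor direction $\tau^{(0)}$ at the initial point $y^{(0)}$ satisfies $$\det\begin{bmatrix}\frac{\partial H}{\partial y\,\partial\lambda}(y^{(0)},1)\\ \tau^{(0)t}\end{bmatrix}<0.$$
   Context: Let $\mathcal{F}=\{x\in\mathbb{R}^n : x>0,\ Ax+q>0\}$ (componentwise) and $\mathcal{F}_1=\mathcal{F}\times\mathbb{R}^n_{++}\times\mathbb{R}^n_{++}$, where $\mathbb{R}^n_{++}$ is the set of vectors with all components positive. A superscript $t$ denotes transpose. For $y=(x,z_1,z_2)\in\mathbb{R}^n\times\mathbb{R}^n\times\mathbb{R}^n$, $y^{(0)}=(x^{(0)},z_1^{(0)},z_2^{(0)})\in\mathcal{F}_1$ and $\lambda\in(0,1]$, the homotopy function is $$H(y,y^{(0)},\lambda)=\begin{bmatrix}(1-\lambda)[(A+A^t)x+q-z_1-A^tz_2]+\lambda(x-x^{(0)})\\ Z_1x-\lambda Z_1^{(0)}x^{(0)}\\ Z_2(Ax+q)-\lambda Z_2^{(0)}(Ax^{(0)}+q)\end{bmatrix},$$ where $Z_i=\mathrm{diag}(z_i)$ and $Z_i^{(0)}=\mathrm{diag}(z_i^{(0)})$ for $i=1,2$. $\Gamma_y^{(0)}$ is the curve starting from $(y^{(0)},1)$ (the connected component containing $(y^{(0)},1)$) in the zero set $\{(y,\lambda)\in\mathcal{F}_1\times(0,1]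 : H(y,y^{(0)},\lambda)=0\}$. The symbol $\frac{\partial H}{\partial y\,\partial\lambda}(y,\lambda)$ denotes the $3n\times(3n+1)$ Jacobian matrix $\left[\frac{\partial H}{\partial y}\ \ \frac{\partial H}{\partial\lambda}\right]$ of $H(\cdot,y^{(0)},\cdot)$ with respect to $(y,\lambda)$. The positive predictor direction at the initial point is $\tau^{(0)}=\frac{1}{c}\begin{bmatrix}s\\-1\end{bmatrix}\in\mathbb{R}^{3n+1}$, where $s=\left(\frac{\partial H}{\partial y}(y^{(0)},1)\right)^{-1}\frac{\partial H}{\partial\lambda}(y^{(0)},1)$ and $c=\left\|\begin{bmatrix}s\\-1\end{bmatrix}\right\|>0$. *)

theory Defs
  imports "HOL-Analysis.Analysis"
begin

type_synonym 'n vec3 = "(real^'n) \<times> (real^'n) \<times> (real^'n)"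

subsection \<open>The homotopy\<close>

definition diag_mat :: "real^'n \<Rightarrow> real^'n^'n" where
  "diag_mat z = (\<chi> i j. if i = j then z $ i else 0)"

definition pos_orthant :: "(real^'n) set" where
  "pos_orthant = {x. \<forall>i. 0 < x $ i}"

definition feas :: "real^'n^'n \<Rightarrow> real^'n \<Rightarrow> (real^'n) set" where
  "feas A q = {x. x \<in> pos_orthant \<and> A *v x + q \<in> pos_orthant}"

definition feas1 :: "real^'n^'n \<Rightarrow> real^'n \<Rightarrow> ('n::finite) vec3 set" where
  "feas1 A q = feas A q \<times> pos_orthant \<times> pos_orthant"

text \<open>The formula is a polynomial in \<open>\<lambda>\<close>, so it is kept total in \<open>\<lambda>\<close>: at \<open>\<lambda> = 1\<close> the
  derivative with respect to \<open>\<lambda>\<close> is the ordinary one. The range \<open>(0,1]\<close> is imposed in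
  \<open>homotopy_zeros\<close>.\<close>

definition homotopy ::
  "real^'n^'n \<Rightarrow> real^'n \<Rightarrow> ('n::finite) vec3 \<Rightarrow> 'n vec3 \<Rightarrow> real \<Rightarrow> 'n vec3" where
  "homotopy A q y y0 lam =
    (case y of (x, z1, z2) \<Rightarrow> case y0 of (x0, z10, z20) \<Rightarrow>
      ((1 - lam) *\<^sub>R ((A + transpose A) *v x + q - z1 - transpose A *v z2) + lam *\<^sub>R (x - x0),
       diag_mat z1 *v x - lam *\<^sub>R (diag_mat z10 *v x0),
       diag_mat z2 *v (A *v x + q) - lam *\<^sub>R (diag_mat z20 *v (A *v x0 + q))))"

definition homotopy_zeros ::
  "real^'n^'n \<Rightarrow> real^'n \<Rightarrow> ('n::finite) vec3 \<Rightarrow> ('n vec3 \<times> real) set" where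
  "homotopy_zeros A q y0 =
    {(y, lam). y \<in> feas1 A q \<and> lam \<in> {0<..1} \<and> homotopy A q y y0 lam = 0}"

definition homotopy_curve ::
  "real^'n^'n \<Rightarrow> real^'n \<Rightarrow> ('n::finite) vec3 \<Rightarrow> ('n vec3 \<times> real) set" where
  "homotopy_curve A q y0 = connected_component_set (homotopy_zeros A q y0) (y0, 1)"

subsection \<open>Smooth curves\<close>

text \<open>\<open>D k\<close> is the \<open>k\<close>-th derivative of \<open>g\<close>, one-sided at end points of the interval \<open>I\<close> that
  belong to it; the second clause is regularity of the parametrization.\<close>

definition smooth_regular_on :: "real set \<Rightarrow> (real \<Rightarrow> 'a::real_normed_vector) \<Rightarrow> bool" where
  "smooth_regular_on I g \<longleftrightarrow>
    (\<exists>D :: nat \<Rightarrow> real \<Rightarrow> 'a. D 0 = g \<and>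
      (\<forall>k. \<forall>t\<in>I. (D k has_vector_derivative D (Suc k) t) (at t within I)) \<and>
      (\<forall>t\<in>I. D 1 t \<noteq> 0))"

text \<open>A smooth curve is an embedded one-dimensional \<open>C\<^sup>\<infinity>\<close> submanifold, possibly with
  boundary. Boundary points must be allowed: \<open>homotopy_curve A q y0\<close> starts at \<open>(y0, 1)\<close>, where
  the constraint \<open>\<lambda> \<le> 1\<close> cuts it off, so that the local parameter interval is half open there.\<close>

definition smooth_curve :: "'a::real_normed_vector set \<Rightarrow> bool" where
  "smooth_curve C \<longleftrightarrow>
    (\<forall>p\<in>C. \<exists>U I g h. open U \<and> p \<in> U \<and> is_interval I \<and> interior I \<noteq> {} \<and>
      smooth_regular_on I g \<and> homeomorphism I (C \<inter> U) g h)"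

subsection \<open>Jacobian matrices and the predictor direction\<close>

text \<open>Coordinates on \<open>\<real>\<^bsup>3n\<^esup>\<close> are indexed by \<open>'n + 'n + 'n\<close>, one summand for each of the blocks
  \<open>x\<close>, \<open>z\<^sub>1\<close>, \<open>z\<^sub>2\<close>, and coordinates on \<open>\<real>\<^bsup>3n+1\<^esup>\<close> by \<open>('n + 'n + 'n) + unit\<close>, with
  \<open>Inr ()\<close> standing for the last coordinate. Rows and columns of the bordered matrix share this
  index type, so its determinant does not depend on how the index type is enumerated.\<close>

definition stack3 :: "('n::finite) vec3 \<Rightarrow> real^('n + 'n + 'n)" where
  "stack3 y = (case y of (u, v, w) \<Rightarrow>
    (\<chi> i. case i of Inl j \<Rightarrow> u $ j | Inr (Inl j) \<Rightarrow> v $ j | Inr (Inr j) \<Rightarrow> w $ j))"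

definition unstack3 :: "real^('n + 'n + 'n) \<Rightarrow> ('n::finite) vec3" where
  "unstack3 v = ((\<chi> j. v $ Inl j), (\<chi> j. v $ Inr (Inl j)), (\<chi> j. v $ Inr (Inr j)))"

lemma unstack3_stack3 [simp]: "unstack3 (stack3 y) = y"
  by (cases y) (simp add: unstack3_def stack3_def)

lemma stack3_unstack3 [simp]: "stack3 (unstack3 v) = v"
  by (simp add: unstack3_def stack3_def vec_eq_iff split: sum.split)

definition append1 :: "real^'m \<Rightarrow> real \<Rightarrow> real^('m::finite + unit)" where
  "append1 v a = (\<chi> i. case i of Inl j \<Rightarrow> v $ j | Inr _ \<Rightarrow> a)"

definition append_col :: "real^'k^'m \<Rightarrow> real^'m \<Rightarrow> real^('k::finite + unit)^'m" where
  "append_col M b = (\<chi> i. append1 (M $ i) (b $ i))"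

definition append_row :: "real^'k^'m \<Rightarrow> real^'k \<Rightarrow> real^'k^('m::finite + unit)" where
  "append_row M r = (\<chi> i. case i of Inl j \<Rightarrow> M $ j | Inr _ \<Rightarrow> r)"

definition dH_dy ::
  "real^'n^'n \<Rightarrow> real^'n \<Rightarrow> ('n::finite) vec3 \<Rightarrow> 'n vec3 \<Rightarrow> real \<Rightarrow> real^('n + 'n + 'n)^('n + 'n + 'n)" where
  "dH_dy A q y0 y lam =
    jacobian (\<lambda>v. stack3 (homotopy A q (unstack3 v) y0 lam)) (at (stack3 y))"

definition dH_dlam ::
  "real^'n^'n \<Rightarrow> real^'n \<Rightarrow> ('n::finite) vec3 \<Rightarrow> 'n vec3 \<Rightarrow> real \<Rightarrow> real^('n + 'n + 'n)" where
  "dH_dlam A q y0 y lam = vector_derivative (\<lambda>t. stack3 (homotopy A q y y0 t)) (at lam)"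

definition dH ::
  "real^'n^'n \<Rightarrow> real^'n \<Rightarrow> ('n::finite) vec3 \<Rightarrow> 'n vec3 \<Rightarrow> real \<Rightarrow>
    real^(('n + 'n + 'n) + unit)^('n + 'n + 'n)" where
  "dH A q y0 y lam = append_col (dH_dy A q y0 y lam) (dH_dlam A q y0 y lam)"

definition predictor_direction ::
  "real^'n^'n \<Rightarrow> real^'n \<Rightarrow> ('n::finite) vec3 \<Rightarrow> real^(('n + 'n + 'n) + unit)" where
  "predictor_direction A q y0 =
    (let s = matrix_inv (dH_dy A q y0 y0 1) *v dH_dlam A q y0 y0 1;
         c = norm (append1 s (- 1))
     in (1 / c) *\<^sub>R append1 s (- 1))"

end

theory Submission
  imports Defs
begin

text \<open>
  At \<open>\<lambda> = 1\<close> the homotopy reduces to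
  \<open>(x - x\<^sup>0, Z\<^sub>1 x - Z\<^sub>1\<^sup>0 x\<^sup>0, Z\<^sub>2 (A x + q) - Z\<^sub>2\<^sup>0 (A x\<^sup>0 + q))\<close>, so its Jacobian \<open>M\<close> with respect to
  \<open>y = (x, z\<^sub>1, z\<^sub>2)\<close> at the initial point is block lower triangular, with diagonal blocks the
  identity, the diagonal matrix of \<open>x\<^sup>0\<close> and the diagonal matrix of \<open>A x\<^sup>0 + q\<close>. Feasibility makes
  the last two positive, hence \<open>det M > 0\<close>; in particular \<open>M\<close> is invertible and
  \<open>s = M\<^sup>-\<^sup>1 b\<close>, where \<open>b\<close> is the \<open>\<lambda>\<close>-derivative, satisfies \<open>M s = b\<close>.

  Bordering \<open>M\<close> by the column \<open>b\<close> and by the row \<open>k (s, -1)\<close> then gives a matrix of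
  determinant \<open>- k (1 + s \<bullet> s) det M\<close>: a column operation turns \<open>b\<close> into \<open>0\<close> and the corner into
  \<open>k (s \<bullet> s + 1)\<close>, at the cost of a factor \<open>-1\<close>. For the predictor direction \<open>k\<close> is the
  reciprocal of a positive norm, so the sign is negative whatever \<open>b\<close> is. The determinant identity
  is \<open>det_bordered_triangular\<close>, and the Jacobian is computed in \<open>dH_dy_initial\<close>.
\<close>

text \<open>Index types such as \<open>'n + 'n + 'n\<close> carry no order, so triangularity is expressed by a rank.
  A permutation preserves the total rank, whereas one contributing to the Leibniz sum can only lower
  the rank of each index; only the identity remains. Within one rank the matrix is diagonal.\<close>

lemma det_triangular_rank:
  fixes M :: "'a::comm_ring_1^'m^'m" and f :: "'m::finite \<Rightarrow> nat"
  assumes tri: "\<And>i j. i \<noteq> j \<Longrightarrow> f i \<le> f j \<Longrightarrow> M $ i $ j = 0"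
  shows "det M = (\<Prod>i\<in>UNIV. M $ i $ i)"
proof -
  \<comment> \<open>A nonvanishing product forces \<open>p\<close> to lower the rank of every index that it moves.\<close>
  have zero: "(\<Prod>i\<in>UNIV. M $ i $ p i) = 0" if p: "p permutes UNIV" and ne: "p \<noteq> id" for p
  proof (rule ccontr)
    assume "(\<Prod>i\<in>UNIV. M $ i $ p i) \<noteq> 0"
    then have nz: "M $ i $ p i \<noteq> 0" for i
      using prod_zero[of UNIV "\<lambda>i. M $ i $ p i"] by auto
    have dec: "p i = i \<or> f (p i) < f i" for i
      using tri[of i "p i"] nz[of i] by (metis not_less)
    obtain k where "p k \<noteq> k" using ne by fastforce
    then have "(\<Sum>i\<in>UNIV. f (p i)) < (\<Sum>i\<in>UNIV. f i)"
      using dec by (intro sum_strict_mono_ex1) (auto intro: less_imp_le, metis less_imp_le order_refl)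
    moreover have "(\<Sum>i\<in>UNIV. f (p i)) = (\<Sum>i\<in>UNIV. f i)"
      using sum.permute[OF p, of f] by (simp add: o_def)
    ultimately show False by simp
  qed
  have "det M = (\<Sum>p\<in>{id}. of_int (sign p) * (\<Prod>i\<in>UNIV. M $ i $ p i))"
    unfolding det_def
    by (rule sum.mono_neutral_right) (auto simp: zero permutes_id finite_permutations)
  then show ?thesis by simp
qed

lemma sum_snoc_index:
  fixes g :: "'m::finite + unit \<Rightarrow> 'a::comm_monoid_add"
  shows "sum g UNIV = (\<Sum>i\<in>UNIV. g (Inl i)) + g (Inr ())"
  using sum.Plus[of "UNIV :: 'm set" "UNIV :: unit set" g] unfolding UNIV_Plus_UNIV
  by (simp add: UNIV_unit)

lemma prod_snoc_index:
  fixes g :: "'m::finite + unit \<Rightarrow> 'a::comm_monoid_mult"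
  shows "prod g UNIV = (\<Prod>i\<in>UNIV. g (Inl i)) * g (Inr ())"
  using prod.Plus[of "UNIV :: 'm set" "UNIV :: unit set" g] unfolding UNIV_Plus_UNIV
  by (simp add: UNIV_unit)

text \<open>Here \<open>s\<close> solves \<open>M s = b\<close>. Multiplying the bordered matrix on the right by
  \<open>[[I, s], [0, -1]]\<close>, of determinant \<open>-1\<close>, replaces the last column \<open>(b, -k)\<close> by
  \<open>(M s - b, k (s \<bullet> s) + k) = (0, k (1 + s \<bullet> s))\<close>. The result is triangular once the new index is
  given a rank above all others.\<close>

lemma det_bordered_triangular:
  fixes M :: "real^'m^'m" and f :: "'m::finite \<Rightarrow> nat"
  assumes tri: "\<And>i j. i \<noteq> j \<Longrightarrow> f i \<le> f j \<Longrightarrow> M $ i $ j = 0"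
    and Ms: "M *v s = b"
  shows "det (append_row (append_col M b) (k *\<^sub>R append1 s (- 1))) = - (k * (1 + s \<bullet> s) * det M)"
proof -
  define N where "N = append_row (append_col M b) (k *\<^sub>R append1 s (- 1))"
  define P :: "real^('m + unit)^('m + unit)"
    where "P = append_row (append_col (mat 1) s) (append1 0 (- 1))"
  define L where "L = append_row (append_col M 0) (k *\<^sub>R append1 s (1 + s \<bullet> s))"
  note entries = append_row_def append_col_def append1_def
  have "(N ** P) $ i $ j = L $ i $ j" for i j
    using arg_cong[OF Ms, of "\<lambda>v. v $ projl i"]
    by (cases i; cases j)
      (auto simp: N_def P_def L_def entries matrix_matrix_mult_def matrix_vector_mult_def
        sum_snoc_index mat_def inner_vec_def sum_distrib_left algebra_simps if_distrib
        cong: if_cong)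
  then have NP: "N ** P = L"
    by (simp add: vec_eq_iff)
  \<comment> \<open>\<open>P\<close> has its extra entries above the diagonal, so its transpose is the lower triangular one.\<close>
  have "det (transpose P) = - 1"
    by (subst det_triangular_rank[where f = "case_sum (\<lambda>_. 0) (\<lambda>_. 1)"])
      (auto simp: P_def entries transpose_def mat_def prod_snoc_index split: sum.splits)
  then have detP: "det P = - 1"
    by simp
  have detL: "det L = det M * (k * (1 + s \<bullet> s))"
    by (subst det_triangular_rank[where f = "case_sum f (\<lambda>_. Suc (Max (range f)))"])
      (auto simp: L_def entries det_triangular_rank[of f M, OF tri] tri prod_snoc_index
        Suc_le_eq not_less split: sum.splits)
  show ?thesis
    using detL detP NP det_mul[of N P] by (simp add: N_def algebra_simps)
qed

lemma invertible_matrix_inv_right: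
  fixes M :: "'a::semiring_1^'n^'m"
  assumes "invertible M"
  shows "M ** matrix_inv M = mat 1"
  using someI_ex[OF assms[unfolded invertible_def]] by (simp add: matrix_inv_def)

definition initial_derivative ::
  "real^'n^'n \<Rightarrow> real^'n \<Rightarrow> ('n::finite) vec3 \<Rightarrow> real^('n + 'n + 'n) \<Rightarrow> real^('n + 'n + 'n)" where
  "initial_derivative A q y0 h =
    (case y0 of (x0, z10, z20) \<Rightarrow> case unstack3 h of (a, b, c) \<Rightarrow>
      stack3 (a,
        \<chi> j. z10 $ j * a $ j + b $ j * x0 $ j,
        \<chi> j. z20 $ j * (A *v a) $ j + c $ j * (A *v x0 + q) $ j))"

lemma has_derivative_vec_componentwise:
  fixes f :: "'a::real_normed_vector \<Rightarrow> real^'m::finite"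
  assumes "\<And>i. ((\<lambda>v. f v $ i) has_derivative (\<lambda>h. f' h $ i)) (at a)"
  shows "(f has_derivative f') (at a)"
  using assms
  by (subst has_derivative_componentwise_within) (auto simp: Basis_vec_def inner_axis)

lemma has_derivative_homotopy_initial:
  fixes A :: "real^'n^'n" and q :: "real^'n" and y0 :: "('n::finite) vec3"
  shows "((\<lambda>v. stack3 (homotopy A q (unstack3 v) y0 1)) has_derivative initial_derivative A q y0)
    (at (stack3 y0))"
proof (rule has_derivative_vec_componentwise)
  fix i :: "'n + 'n + 'n"
  obtain x0 z10 z20 where y0: "y0 = (x0, z10, z20)"
    by (cases y0)
  note [derivative_intros] = bounded_linear.has_derivative[OF bounded_linear_vec_nth]
  note unfold = y0 initial_derivative_def stack3_def unstack3_def homotopy_def diag_mat_def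
    matrix_vector_mult_def if_distrib[of "\<lambda>x. x * _"]
  consider j where "i = Inl j" | j where "i = Inr (Inl j)" | j where "i = Inr (Inr j)"
    by (metis sum.exhaust)
  then show "((\<lambda>v. stack3 (homotopy A q (unstack3 v) y0 1) $ i) has_derivative
      (\<lambda>h. initial_derivative A q y0 h $ i)) (at (stack3 y0))"
    by cases (auto simp: unfold cong: if_cong intro!: derivative_eq_intros)
qed

lemma dH_dy_initial: "dH_dy A q y0 y0 1 = matrix (initial_derivative A q y0)"
  unfolding dH_dy_def jacobian_def
  using frechet_derivative_at[OF has_derivative_homotopy_initial[of A q y0]] by simp

text \<open>The rows of the \<open>x\<close> block form the identity, and in the other rows the columns of \<open>z\<^sub>1\<close> and
  \<open>z\<^sub>2\<close> contribute only diagonal entries. Hence rank \<open>0\<close> for the \<open>x\<close> block and rank \<open>1\<close> for both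
  others exhibits the Jacobian as triangular.\<close>

lemma dH_dy_initial_triangular:
  assumes "i \<noteq> j" and "case_sum (\<lambda>_. 0) (\<lambda>_. 1) i \<le> (case_sum (\<lambda>_. 0) (\<lambda>_. 1) j :: nat)"
  shows "dH_dy A q y0 y0 1 $ i $ j = 0"
  using assms
  by (cases y0)
    (auto simp: dH_dy_initial matrix_def initial_derivative_def stack3_def unstack3_def axis_def
      matrix_vector_mult_def split: sum.splits)

lemma det_dH_dy_initial_pos:
  assumes "y0 \<in> feas1 A q"
  shows "0 < det (dH_dy A q y0 y0 1)"
proof -
  have "0 < dH_dy A q y0 y0 1 $ i $ i" for i
    using assms
    by (cases y0)
      (auto simp: dH_dy_initial matrix_def initial_derivative_def stack3_def unstack3_def axis_def
        matrix_vector_mult_def feas1_def feas_def pos_orthant_def split: sum.splits)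
  then show ?thesis
    by (subst det_triangular_rank[OF dH_dy_initial_triangular]) (auto intro: prod_pos)
qed

theorem theorem3p10:
  fixes A :: "real^'n^'n" and q :: "real^'n" and y0 :: "('n::finite) vec3"
  assumes "y0 \<in> feas1 A q"
    and "smooth_curve (homotopy_curve A q y0)"
  shows "det (append_row (dH A q y0 y0 1) (predictor_direction A q y0)) < 0"
proof -
  define M where "M = dH_dy A q y0 y0 1"
  define b where "b = dH_dlam A q y0 y0 1"
  define s where "s = matrix_inv M *v b"
  define k where "k = 1 / norm (append1 s (- 1))"
  have det_pos: "0 < det M"
    using det_dH_dy_initial_pos[OF assms(1)] by (simp add: M_def)
  then have "invertible M"
    by (simp add: invertible_det_nz)
  then have Ms: "M *v s = b"
    by (simp add: s_def matrix_vector_mul_assoc invertible_matrix_inv_right)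
  have "append1 s (- 1) $ Inr () \<noteq> 0"
    by (simp add: append1_def)
  then have "append1 s (- 1) \<noteq> 0"
    by (metis zero_index)
  then have "0 < k"
    by (simp add: k_def)
  moreover have "0 < 1 + s \<bullet> s"
    by (simp add: add_pos_nonneg)
  moreover have "det (append_row (dH A q y0 y0 1) (predictor_direction A q y0))
      = - (k * (1 + s \<bullet> s) * det M)"
    using det_bordered_triangular[OF dH_dy_initial_triangular Ms[unfolded M_def], where k = k]
    by (simp add: dH_def predictor_direction_def Let_def M_def b_def s_def k_def)
  ultimately show ?thesis
    using det_pos by simp
qed

end
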